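(* Let $(v_1,\ldots,v_p)$ be a basis of a subspace $V\subset X$ and $(w_1,\ldots,w_q)$ a basis of a subspace $W\subset X$. Let $A=\big(\langle w_i,w_j\rangle\big)$ ($q\times q$), $B=\big(\langle w_i,v_j\rangle\big)$ ($q\times p$) and $D=\big(\langle v_i,v_j\rangle\big)$ ($p\times p$). Then $$\cos^2 \Theta^\perp_{V,W} = \frac{\det(A-BD^{-1}\bar{B}^T )}{\det A},$$ where $\bar B^T$ is the conjugate transpose of $B$ (the transpose in the real case).
   Context: $X$ is an $n$-dimensional vector space over $\mathbb{R}$ (real case) or $\mathbb{C}$ (complex case) with inner product $\langle\cdot,\cdot\rangle$ (Hermitian in the complex case, conjugate-linear in the first argument). Blades: a $p$-blade is a simple multivector $\nu=v_1\wedge\cdots\wedge v_p\in\Lambda^pX$; if $\nu\neq0$ it represents the $p$-dimensional subspace $V=\mathrm{span}(v_1,\ldots,v_p)$. Nonzero scalars in $\Lambda^0X$ are $0$-blades representing $\{0\}$. $\Lambda X$ has the inner product given on $p$-blades by $\langle v_1\wedge\cdots\wedge v_p,\,w_1\wedge\cdots\wedge w_p\rangle=\det(\langle v_i,w_j\rangle)$, extended (sesqui)linearly, with distinct grades orthogonal; $\|\nu\|=\sqrt{\langle\nu,\nu\rangle}$. Grassmann angle: for subspaces $V,W\subset X$, let $P$ be the orthogonal projection of $X$ onto $W$, acting on blades by $P(v_1\wedge\cdots\wedge v_p)=Pv_1\wedge\cdots\wedge Pv_p$ (identity on scalars). The Grassmann angle $\Theta_{V,W}\in[0,\frac\pi2]$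 is defined by $\cos\Theta_{V,W}=\|P\nu\|/\|\nu\|$ for any nonzero blade $\nu$ representing $V$ (independent of $\nu$). The complementary Grassmann angle is $\Theta^\perp_{V,W}=\Theta_{V,W^\perp}$, where $W^\perp$ is the orthogonal complement of $W$ in $X$. *)

theory Defs
  imports
    Complex_Main
    "HOL-Library.Poly_Mapping"
    "Jordan_Normal_Form.Conjugate"
    "Jordan_Normal_Form.Determinant"
    "Jordan_Normal_Form.Gauss_Jordan_Elimination"
begin

section \<open>Scalars: the real or the complex numbers\<close>

text \<open>
  The last axiom forces conjugation to be the usual one: up to isomorphism the only instances
  are the reals with the identity and the complex numbers with complex conjugation
  (a normed field over the reals with multiplicative norm is one of these two).
\<close>

class real_or_complex = conjugatable_field + real_normed_field +
  fixes re :: "'a \<Rightarrow> real"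
  assumes re_scaleR_one: "re x *\<^sub>R 1 = (x + conjugate x) / 2"
    and conjugate_mult_self: "conjugate x * x = (norm x)\<^sup>2 *\<^sub>R 1"

instantiation real :: real_or_complex
begin
definition re_real :: "real \<Rightarrow> real" where [simp]: "re_real x = x"
instance by standard (auto simp: power2_eq_square)
end

instantiation complex :: real_or_complex
begin
definition re_complex :: "complex \<Rightarrow> real" where [simp]: "re_complex x = Re x"
instance
proof
  fix x :: complex
  show "re x *\<^sub>R 1 = (x + conjugate x) / 2"
    by (simp add: complex_eq_iff)
  show "conjugate x * x = (norm x)\<^sup>2 *\<^sub>R 1"
    using complex_norm_square[of x] by (simp add: mult.commute scaleR_conv_of_real)
qed
end


section \<open>Formal linear combinations\<close>

definition fscale :: "'k::field \<Rightarrow> ('b \<Rightarrow>\<^sub>0 'k) \<Rightarrow> ('b \<Rightarrow>\<^sub>0 'k)" where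
  "fscale c f = Poly_Mapping.map ((*) c) f"

lemma lookup_fscale: "Poly_Mapping.lookup (fscale c f) b = c * Poly_Mapping.lookup f b"
  by (simp add: fscale_def map.rep_eq when_def)

global_interpretation free: vector_space fscale
  by unfold_locales
    (auto intro!: poly_mapping_eqI simp: lookup_fscale lookup_add algebra_simps)


section \<open>Inner product spaces and their exterior algebra\<close>

text \<open>
  The space is the whole type \<open>'x\<close>; its dimension is the cardinality of \<open>Basis\<close>,
  an arbitrary (not necessarily orthonormal) finite basis.
\<close>

locale inner_space = finite_dimensional_vector_space scale Basis
  for scale :: "'k::real_or_complex \<Rightarrow> 'x::ab_group_add \<Rightarrow> 'x" (infixr "*s" 75)
    and Basis :: "'x set" +
  fixes ip :: "'x \<Rightarrow> 'x \<Rightarrow> 'k"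
  assumes ip_add_right: "ip x (y + z) = ip x y + ip x z"
    and ip_scale_right: "ip x (c *s y) = c * ip x y"
    and ip_conjugate: "ip y x = conjugate (ip x y)"
    and ip_pos: "x \<noteq> 0 \<Longrightarrow> re (ip x x) > 0"
begin

definition ordered_basis :: "'x list \<Rightarrow> 'x set \<Rightarrow> bool" where
  "ordered_basis vs V \<longleftrightarrow> distinct vs \<and> independent (set vs) \<and> span (set vs) = V"

text \<open>
  The exterior algebra is realised as the space of formal linear combinations of lists of
  vectors, the list \<open>[v\<^sub>1, \<dots>, v\<^sub>p]\<close> standing for the wedge product of its entries, modulo the
  relations that make this product multilinear and alternating. Its elements are cosets; the
  part of degree \<open>p\<close> is generated by the lists of length \<open>p\<close>, and the empty list is the scalar 1.
\<close>

definition ext_relations :: "('x list \<Rightarrow>\<^sub>0 'k) set" where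
  "ext_relations =
     {Poly_Mapping.single (us @ (x + y) # vs) 1
        - Poly_Mapping.single (us @ x # vs) 1
        - Poly_Mapping.single (us @ y # vs) 1 | us vs x y. True} \<union>
     {Poly_Mapping.single (us @ (c *s x) # vs) 1
        - Poly_Mapping.single (us @ x # vs) c | us vs c x. True} \<union>
     {Poly_Mapping.single (us @ x # vs @ x # ws) 1 | us vs ws x. True}"

definition ext_class :: "('x list \<Rightarrow>\<^sub>0 'k) \<Rightarrow> ('x list \<Rightarrow>\<^sub>0 'k) set" where
  "ext_class f = {g. g - f \<in> free.span ext_relations}"

text \<open>
  The scalar \<open>c\<close> is there for the blades of degree 0; in positive degree it can be absorbed in
  one of the factors.
\<close>

definition blade_of :: "'k \<Rightarrow> 'x list \<Rightarrow> ('x list \<Rightarrow>\<^sub>0 'k) set" where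
  "blade_of c vs = ext_class (Poly_Mapping.single vs c)"

definition represents :: "('x list \<Rightarrow>\<^sub>0 'k) set \<Rightarrow> 'x set \<Rightarrow> bool" where
  "represents \<nu> V \<longleftrightarrow>
     \<nu> \<noteq> ext_class 0 \<and> (\<exists>c vs. \<nu> = blade_of c vs \<and> V = span (set vs))"

definition list_ip :: "'x list \<Rightarrow> 'x list \<Rightarrow> 'k" where
  "list_ip vs ws =
     (if length vs = length ws
      then det (mat (length vs) (length ws) (\<lambda>(i, j). ip (vs ! i) (ws ! j)))
      else 0)"

definition free_ip :: "('x list \<Rightarrow>\<^sub>0 'k) \<Rightarrow> ('x list \<Rightarrow>\<^sub>0 'k) \<Rightarrow> 'k" where
  "free_ip f g =
     (\<Sum>vs\<in>Poly_Mapping.keys f. \<Sum>ws\<in>Poly_Mapping.keys g.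
        conjugate (Poly_Mapping.lookup f vs) * Poly_Mapping.lookup g ws * list_ip vs ws)"

text \<open>
  Below, a function on the exterior algebra induced by one on formal linear combinations is
  introduced as the common value on all representatives of a coset.
\<close>

definition ext_ip :: "('x list \<Rightarrow>\<^sub>0 'k) set \<Rightarrow> ('x list \<Rightarrow>\<^sub>0 'k) set \<Rightarrow> 'k" where
  "ext_ip \<mu> \<nu> = (THE z. \<forall>f\<in>\<mu>. \<forall>g\<in>\<nu>. free_ip f g = z)"

definition ext_norm :: "('x list \<Rightarrow>\<^sub>0 'k) set \<Rightarrow> real" where
  "ext_norm \<nu> = sqrt (re (ext_ip \<nu> \<nu>))"

definition free_map :: "('x \<Rightarrow> 'x) \<Rightarrow> ('x list \<Rightarrow>\<^sub>0 'k) \<Rightarrow> ('x list \<Rightarrow>\<^sub>0 'k)" where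
  "free_map P f =
     (\<Sum>vs\<in>Poly_Mapping.keys f. Poly_Mapping.single (map P vs) (Poly_Mapping.lookup f vs))"

definition ext_map :: "('x \<Rightarrow> 'x) \<Rightarrow> ('x list \<Rightarrow>\<^sub>0 'k) set \<Rightarrow> ('x list \<Rightarrow>\<^sub>0 'k) set" where
  "ext_map P \<nu> = (THE \<mu>. \<forall>f\<in>\<nu>. ext_class (free_map P f) = \<mu>)"


section \<open>Grassmann angles\<close>

definition orth_compl :: "'x set \<Rightarrow> 'x set" where
  "orth_compl W = {x. \<forall>w\<in>W. ip w x = 0}"

definition orth_proj :: "'x set \<Rightarrow> 'x \<Rightarrow> 'x" where
  "orth_proj W x = (THE y. y \<in> W \<and> x - y \<in> orth_compl W)"

definition grassmann_angle :: "'x set \<Rightarrow> 'x set \<Rightarrow> real" where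
  "grassmann_angle V W =
     (THE \<theta>. 0 \<le> \<theta> \<and> \<theta> \<le> pi / 2 \<and>
        (\<forall>\<nu>. represents \<nu> V \<longrightarrow>
           cos \<theta> = ext_norm (ext_map (orth_proj W) \<nu>) / ext_norm \<nu>))"

definition compl_grassmann_angle :: "'x set \<Rightarrow> 'x set \<Rightarrow> real" where
  "compl_grassmann_angle V W = grassmann_angle V (orth_compl W)"

end

end

theory Submission
  imports Defs
begin

text \<open>
  Let \<open>P\<close> be the orthogonal projection onto the orthogonal complement of \<open>W\<close>. Subtracting from
  each \<open>v\<^sub>j\<close> its component in \<open>W\<close> changes neither the wedge product
  \<open>w\<^sub>1 \<and> \<dots> \<and> w\<^sub>q \<and> v\<^sub>1 \<and> \<dots> \<and> v\<^sub>p\<close> nor, therefore, its Gram determinant, and makes the Gram matrix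
  block diagonal. Hence this determinant equals \<open>det A\<close> times the squared norm of \<open>Pv\<^sub>1 \<and> \<dots> \<and> Pv\<^sub>p\<close>.
  By the Schur complement it also equals \<open>det (A - B D\<^sup>-\<^sup>1 B\<^sup>*) det D\<close>, where \<open>det D\<close> is the
  squared norm of \<open>v\<^sub>1 \<and> \<dots> \<and> v\<^sub>p\<close>.
\<close>

section \<open>The scalar field\<close>

lemma conjugate_one: "conjugate (1::'k::real_or_complex) = 1"
proof -
  have "conjugate 1 * conjugate 1 = conjugate (1::'k) * 1"
    using conjugate_dist_mul[of 1 "1::'k"] by simp
  then show ?thesis
    by (metis conjugate_zero_iff mult_cancel_left zero_neq_one)
qed

lemma comm_ring_hom_conjugate: "comm_ring_hom (conjugate :: 'k::real_or_complex \<Rightarrow> 'k)"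
  by unfold_locales (auto simp: conjugate_dist_mul conjugate_dist_add conjugate_one)

lemma conjugate_mult_self_of_real:
  "conjugate x * x = of_real ((norm (x::'k::real_or_complex))\<^sup>2)"
  by (simp add: conjugate_mult_self scaleR_conv_of_real)

text \<open>Cancel \<open>r\<close> in conjugate(r) r = |r|^2 = r^2; only \<open>r = 0\<close> has
  to be set apart.\<close>

lemma conjugate_of_real [simp]: "conjugate (of_real r) = (of_real r :: 'k::real_or_complex)"
proof (cases "r = 0")
  case False
  have "conjugate (of_real r) * of_real r = (of_real r * of_real r :: 'k)"
    by (simp add: conjugate_mult_self_of_real power2_eq_square)
  with False show ?thesis by simp
qed simp

lemma of_real_re: "conjugate x = x \<Longrightarrow> of_real (re x) = (x::'k::real_or_complex)"
  using re_scaleR_one[of x] by (simp add: scaleR_conv_of_real)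

lemma re_of_real [simp]: "re (of_real r :: 'k::real_or_complex) = r"
  using of_real_re[of "of_real r :: 'k"] by (simp add: of_real_eq_iff)

lemma re_0 [simp]: "re (0 :: 'k::real_or_complex) = 0"
  using re_of_real[of 0, where 'k='k] by simp

section \<open>Linear extension of functions on the generators\<close>

text \<open>Terms outside the support vanish, so sums over different supports can be compared over
  one common finite set.\<close>

lemma sum_keys_superset:
  fixes h :: "'b \<Rightarrow> 'k::zero \<Rightarrow> 'c::comm_monoid_add"
  assumes "\<And>b. h b 0 = 0" "finite K" "Poly_Mapping.keys f \<subseteq> K"
  shows "(\<Sum>b\<in>Poly_Mapping.keys f. h b (Poly_Mapping.lookup f b)) =
    (\<Sum>b\<in>K. h b (Poly_Mapping.lookup f b))"
  using assms by (intro sum.mono_neutral_left) (auto simp: in_keys_iff)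

lemma sum_keys_add:
  fixes h :: "'b \<Rightarrow> 'k::comm_monoid_add \<Rightarrow> 'c::comm_monoid_add"
  assumes h0: "\<And>b. h b 0 = 0" and hadd: "\<And>b x y. h b (x + y) = h b x + h b y"
  shows "(\<Sum>b\<in>Poly_Mapping.keys (f + g). h b (Poly_Mapping.lookup (f + g) b)) =
    (\<Sum>b\<in>Poly_Mapping.keys f. h b (Poly_Mapping.lookup f b)) +
    (\<Sum>b\<in>Poly_Mapping.keys g. h b (Poly_Mapping.lookup g b))"
proof -
  let ?K = "Poly_Mapping.keys f \<union> Poly_Mapping.keys g"
  have *: "Poly_Mapping.keys (f + g) \<subseteq> ?K"
    by (rule Poly_Mapping.keys_add)
  have "(\<Sum>b\<in>Poly_Mapping.keys (f + g). h b (Poly_Mapping.lookup (f + g) b)) =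
      (\<Sum>b\<in>?K. h b (Poly_Mapping.lookup f b)) + (\<Sum>b\<in>?K. h b (Poly_Mapping.lookup g b))"
    using sum_keys_superset[of h ?K "f + g"] * h0 by (simp add: lookup_add hadd sum.distrib)
  then show ?thesis
    using sum_keys_superset[of h ?K f] sum_keys_superset[of h ?K g] h0 by simp
qed

lemma sum_keys_fscale:
  fixes h :: "'b \<Rightarrow> 'k::field \<Rightarrow> 'c::comm_monoid_add"
  assumes h0: "\<And>b. h b 0 = 0"
  shows "(\<Sum>b\<in>Poly_Mapping.keys (fscale c f). h b (Poly_Mapping.lookup (fscale c f) b)) =
    (\<Sum>b\<in>Poly_Mapping.keys f. h b (c * Poly_Mapping.lookup f b))"
proof -
  have "Poly_Mapping.keys (fscale c f) \<subseteq> Poly_Mapping.keys f"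
    by (auto simp: in_keys_iff lookup_fscale)
  from sum_keys_superset[of h, OF h0 _ this] show ?thesis
    by (simp add: lookup_fscale)
qed

lemma fscale_single: "fscale c (Poly_Mapping.single b x) = Poly_Mapping.single b (c * x)"
  by (intro poly_mapping_eqI) (simp add: lookup_fscale lookup_single when_def)

definition linear_extension :: "('b \<Rightarrow> 'k::field) \<Rightarrow> ('b \<Rightarrow>\<^sub>0 'k) \<Rightarrow> 'k" where
  "linear_extension h f = (\<Sum>b\<in>Poly_Mapping.keys f. Poly_Mapping.lookup f b * h b)"

lemma linear_extension_0 [simp]: "linear_extension h 0 = 0"
  by (simp add: linear_extension_def)

lemma linear_extension_add:
  "linear_extension h (f + g) = linear_extension h f + linear_extension h g"
  unfolding linear_extension_def
  by (rule sum_keys_add[where h = "\<lambda>b x. x * h b"]) (auto simp: algebra_simps)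

lemma linear_extension_fscale: "linear_extension h (fscale c f) = c * linear_extension h f"
  unfolding linear_extension_def sum_distrib_left
  by (subst sum_keys_fscale[where h = "\<lambda>b x. x * h b"]) (auto simp: algebra_simps)

lemma linear_extension_diff:
  "linear_extension h (f - g) = linear_extension h f - linear_extension h g"
  using linear_extension_add[of h "f - g" g] by simp

lemma linear_extension_single [simp]: "linear_extension h (Poly_Mapping.single b c) = c * h b"
  by (simp add: linear_extension_def)

context inner_space
begin

section \<open>The inner product on the exterior algebra\<close>

lemma ip_add_left: "ip (x + y) z = ip x z + ip y z"
  using ip_add_right[of z x y] ip_conjugate conjugate_dist_add by metis

lemma ip_scale_left: "ip (c *s x) y = conjugate c * ip x y"
  using ip_scale_right[of y c x] ip_conjugate conjugate_dist_mul by metis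

lemma ip_zero_right [simp]: "ip x 0 = 0"
  using ip_add_right[of x 0 0] by simp

lemma ip_zero_left [simp]: "ip 0 x = 0"
  using ip_add_left[of 0 0 x] by simp

lemma ip_diff_right: "ip x (y - z) = ip x y - ip x z"
  using ip_add_right[of x "y - z" z] by simp

lemma ip_sum_right: "ip x (\<Sum>i\<in>I. f i) = (\<Sum>i\<in>I. ip x (f i))"
  by (induction I rule: infinite_finite_induct) (auto simp: ip_add_right)

lemma ip_eq_0_commute: "ip x y = 0 \<longleftrightarrow> ip y x = 0"
  using ip_conjugate[of x y] by simp

lemma ip_self: "ip x x = of_real (re (ip x x))"
  by (simp add: of_real_re ip_conjugate[of x x, symmetric])

lemma re_ip_nonneg: "re (ip x x) \<ge> 0"
  using ip_pos[of x] by (cases "x = 0") auto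

lemma ip_self_eq_0_iff: "ip x x = 0 \<longleftrightarrow> x = 0"
  using ip_pos[of x] by (cases "x = 0") auto

text \<open>Pythagoras. Both squared norms are written as \<open>of_real\<close> values, so
  \<open>re_of_real\<close> does the work of additivity of \<open>re\<close>.\<close>

lemma re_ip_add_orthogonal:
  assumes "ip x y = 0"
  shows "re (ip (x + y) (x + y)) = re (ip x x) + re (ip y y)"
proof -
  have "ip (x + y) (x + y) = ip x x + ip y y"
    using assms ip_eq_0_commute[of x y] by (simp add: ip_add_left ip_add_right)
  then have "ip (x + y) (x + y) = of_real (re (ip x x) + re (ip y y))"
    using ip_self[of x] ip_self[of y] by simp
  then show ?thesis by (simp only: re_of_real)
qed

section \<open>Gram determinants as multilinear alternating functions\<close>

lemma list_ip_conjugate: "list_ip ws vs = conjugate (list_ip vs ws)"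
proof (cases "length vs = length ws")
  case True
  let ?M = "\<lambda>vs ws. mat (length vs) (length ws) (\<lambda>(i, j). ip (vs ! i) (ws ! j))"
  have "?M ws vs = transpose_mat (map_mat conjugate (?M vs ws))"
    by (intro eq_matI) (auto intro: ip_conjugate)
  then show ?thesis
    using True det_transpose[of "map_mat conjugate (?M vs ws)" "length vs"]
    by (simp add: list_ip_def comm_ring_hom.hom_det[OF comm_ring_hom_conjugate])
qed (simp add: list_ip_def)

text \<open>Expand along the column that holds the varying vector: its cofactors do not see that
  vector, so \<open>C\<close> is computed with 0 in its place. This is the source of linearity in
  each slot.\<close>

lemma list_ip_laplace:
  assumes "length vs = length (us @ u # ws)"
  obtains C where "\<And>x. list_ip vs (us @ x # ws) = (\<Sum>i<length vs. ip (vs ! i) x * C i)"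
proof
  let ?n = "length vs" and ?k = "length us"
  let ?M = "\<lambda>x. mat ?n ?n (\<lambda>(i, j). ip (vs ! i) ((us @ x # ws) ! j))"
  fix x
  have k: "?k < ?n" using assms by simp
  have "list_ip vs (us @ x # ws) = det (?M x)"
    using assms by (simp add: list_ip_def)
  also have "\<dots> = (\<Sum>i<?n. ?M x $$ (i, ?k) * cofactor (?M x) i ?k)"
    using k by (intro laplace_expansion_column) auto
  also have "\<dots> = (\<Sum>i<?n. ip (vs ! i) x * cofactor (?M 0) i ?k)"
  proof (intro sum.cong refl arg_cong2[of _ _ _ _ "(*)"])
    fix i assume "i \<in> {..<?n}"
    then show "?M x $$ (i, ?k) = ip (vs ! i) x" using k by simp
    have "mat_delete (?M x) i ?k = mat_delete (?M 0) i ?k"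
      by (rule eq_matI) (use k in \<open>auto simp: mat_delete_def nth_append nth_Cons'\<close>)
    then show "cofactor (?M x) i ?k = cofactor (?M 0) i ?k"
      by (simp add: cofactor_def)
  qed
  finally show "list_ip vs (us @ x # ws) = (\<Sum>i<?n. ip (vs ! i) x * cofactor (?M 0) i ?k)" .
qed

lemma list_ip_add:
  "list_ip vs (us @ (x + y) # ws) = list_ip vs (us @ x # ws) + list_ip vs (us @ y # ws)"
proof (cases "length vs = length (us @ x # ws)")
  case True
  then obtain C where "\<And>x. list_ip vs (us @ x # ws) = (\<Sum>i<length vs. ip (vs ! i) x * C i)"
    using list_ip_laplace by blast
  then show ?thesis by (simp add: ip_add_right algebra_simps sum.distrib)
qed (simp add: list_ip_def)

lemma list_ip_scale: "list_ip vs (us @ (c *s x) # ws) = c * list_ip vs (us @ x # ws)"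
proof (cases "length vs = length (us @ x # ws)")
  case True
  then obtain C where "\<And>x. list_ip vs (us @ x # ws) = (\<Sum>i<length vs. ip (vs ! i) x * C i)"
    using list_ip_laplace by blast
  then show ?thesis by (simp add: ip_scale_right sum_distrib_left mult.assoc)
qed (simp add: list_ip_def)

lemma list_ip_repeated: "list_ip vs (us @ x # ws @ x # zs) = 0"
proof (cases "length vs = length (us @ x # ws @ x # zs)")
  case True
  let ?n = "length vs" and ?xs = "us @ x # ws @ x # zs"
  let ?M = "mat ?n ?n (\<lambda>(i, j). ip (vs ! i) (?xs ! j))"
  let ?k = "length us" and ?l = "length us + 1 + length ws"
  have "?xs ! ?k = x" "?xs ! ?l = x"
    by (auto simp: nth_append)
  then have "col ?M ?k = col ?M ?l"
    using True by (intro eq_vecI) auto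
  then have "det ?M = 0"
    using True by (intro det_identical_columns[of ?M ?n ?k ?l]) auto
  then show ?thesis using True by (simp add: list_ip_def)
qed (simp add: list_ip_def)

text \<open>The kernel of a linear functional is a subspace, so checking the three kinds of
  generating relations suffices. Thus \<open>list_ip\<close> descends to the quotient in its second
  argument.\<close>

lemma linear_extension_list_ip_relation:
  assumes "r \<in> free.span ext_relations"
  shows "linear_extension (list_ip vs) r = 0"
proof -
  have "free.subspace {r. linear_extension (list_ip vs) r = 0}"
    by (auto simp: free.subspace_def linear_extension_add linear_extension_fscale)
  moreover have "ext_relations \<subseteq> {r. linear_extension (list_ip vs) r = 0}"
    by (auto simp: ext_relations_def linear_extension_diff list_ip_add list_ip_scale list_ip_repeated)
  ultimately show ?thesis
    using assms free.span_minimal by blast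
qed

lemma free_ip_eq:
  "free_ip f g =
    (\<Sum>vs\<in>Poly_Mapping.keys f. conjugate (Poly_Mapping.lookup f vs) * linear_extension (list_ip vs) g)"
  by (simp add: free_ip_def linear_extension_def sum_distrib_left mult.assoc)

lemma free_ip_conjugate: "free_ip g f = conjugate (free_ip f g)"
proof -
  have "conjugate (free_ip f g) =
    (\<Sum>vs\<in>Poly_Mapping.keys f. \<Sum>ws\<in>Poly_Mapping.keys g.
      conjugate (Poly_Mapping.lookup g ws) * Poly_Mapping.lookup f vs * list_ip ws vs)"
    unfolding free_ip_def
    by (auto simp: sum_conjugate conjugate_dist_mul mult_ac intro!: sum.cong)
      (metis list_ip_conjugate)
  also have "\<dots> = free_ip g f"
    unfolding free_ip_def by (rule sum.swap)
  finally show ?thesis ..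
qed

lemma free_ip_cong_right:
  assumes "g - g' \<in> free.span ext_relations"
  shows "free_ip f g = free_ip f g'"
  using linear_extension_list_ip_relation[OF assms]
  by (simp add: free_ip_eq linear_extension_diff)

lemma free_ip_cong:
  assumes "f - f' \<in> free.span ext_relations" "g - g' \<in> free.span ext_relations"
  shows "free_ip f g = free_ip f' g'"
  using free_ip_cong_right[OF assms(1), of g] free_ip_cong_right[OF assms(2), of f']
    free_ip_conjugate[of f g] free_ip_conjugate[of f' g] by simp

section \<open>Cosets and the induced inner product\<close>

lemma mem_ext_class_self: "f \<in> ext_class f"
  by (simp add: ext_class_def free.span_zero)

lemma ext_class_eq_iff: "ext_class f = ext_class g \<longleftrightarrow> f - g \<in> free.span ext_relations"
proof
  show "f - g \<in> free.span ext_relations" if "ext_class f = ext_class g"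
    using mem_ext_class_self[of f] unfolding that by (simp add: ext_class_def)
  assume fg: "f - g \<in> free.span ext_relations"
  show "ext_class f = ext_class g"
    unfolding ext_class_def
  proof (intro Collect_cong iffI)
    fix h
    show "h - g \<in> free.span ext_relations" if "h - f \<in> free.span ext_relations"
      using free.span_add[OF that fg] by simp
    show "h - f \<in> free.span ext_relations" if "h - g \<in> free.span ext_relations"
      using free.span_diff[OF that fg] by simp
  qed
qed

text \<open>Independence of the representatives gives existence of the value described in
  \<open>ext_ip\<close>; evaluation at \<open>f\<close> and \<open>g\<close> themselves gives
  uniqueness.\<close>

lemma ext_ip_ext_class: "ext_ip (ext_class f) (ext_class g) = free_ip f g"
  unfolding ext_ip_def
proof (rule the_equality)
  show "\<forall>f'\<in>ext_class f. \<forall>g'\<in>ext_class g. free_ip f' g' = free_ip f g"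
    by (auto simp: ext_class_def intro: free_ip_cong)
  then show "z = free_ip f g" if "\<forall>f'\<in>ext_class f. \<forall>g'\<in>ext_class g. free_ip f' g' = z" for z
    using that mem_ext_class_self by metis
qed

text \<open>The squared norm of the wedge product of \<open>xs\<close>. Taking \<open>re\<close>
  loses nothing, because this determinant is its own conjugate.\<close>

definition gram :: "'x list \<Rightarrow> real" where
  "gram xs = re (list_ip xs xs)"

lemma list_ip_self: "list_ip xs xs = of_real (gram xs)"
  by (simp add: gram_def of_real_re list_ip_conjugate[of xs xs, symmetric])

lemma ext_norm_blade_of: "ext_norm (blade_of c us) = norm c * sqrt (gram us)"
proof -
  have "free_ip (Poly_Mapping.single us c) (Poly_Mapping.single us c) =
      conjugate c * c * list_ip us us"
    by (cases "c = 0") (auto simp: free_ip_eq)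
  also have "\<dots> = of_real ((norm c)\<^sup>2 * gram us)"
    by (simp add: conjugate_mult_self_of_real list_ip_self)
  finally have "re (free_ip (Poly_Mapping.single us c) (Poly_Mapping.single us c)) = (norm c)\<^sup>2 * gram us"
    by (simp only: re_of_real)
  then show ?thesis
    by (simp add: ext_norm_def blade_of_def ext_ip_ext_class real_sqrt_mult)
qed

section \<open>Linear maps induced on the exterior algebra\<close>

lemma free_map_add: "free_map P (f + g) = free_map P f + free_map P g"
  unfolding free_map_def
  by (rule sum_keys_add[where h = "\<lambda>b x. Poly_Mapping.single (map P b) x"])
    (auto simp: single_add)

lemma free_map_fscale: "free_map P (fscale c f) = fscale c (free_map P f)"
  unfolding free_map_def
  by (subst sum_keys_fscale[where h = "\<lambda>b x. Poly_Mapping.single (map P b) x"])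
    (auto simp: free.scale_sum_right fscale_single)

lemma free_map_diff: "free_map P (f - g) = free_map P f - free_map P g"
  using free_map_add[of P "f - g" g] by simp

lemma free_map_single [simp]:
  "free_map P (Poly_Mapping.single us c) = Poly_Mapping.single (map P us) c"
  by (cases "c = 0") (auto simp: free_map_def)

text \<open>A linear map applied entrywise carries each generating relation to one of the same kind.
  This is what makes \<open>ext_map\<close> well defined.\<close>

lemma free_map_relation:
  assumes P: "module_hom scale scale P" and r: "r \<in> free.span ext_relations"
  shows "free_map P r \<in> free.span ext_relations"
proof -
  have "free.subspace {r. free_map P r \<in> free.span ext_relations}"
    by (auto simp: free.subspace_def free_map_add free_map_fscale free.span_add free.span_scale
        free.span_zero) (simp add: free_map_def free.span_zero)
  moreover have "free_map P ` ext_relations \<subseteq> ext_relations"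
    using module_hom.add[OF P] module_hom.scale[OF P]
    by (fastforce simp: ext_relations_def free_map_diff)
  then have "ext_relations \<subseteq> {r. free_map P r \<in> free.span ext_relations}"
    using free.span_base by blast
  ultimately show ?thesis
    using r free.span_minimal by blast
qed

lemma ext_map_ext_class:
  assumes "module_hom scale scale P"
  shows "ext_map P (ext_class f) = ext_class (free_map P f)"
  unfolding ext_map_def
proof (rule the_equality)
  show *: "\<forall>g\<in>ext_class f. ext_class (free_map P g) = ext_class (free_map P f)"
    using free_map_relation[OF assms] unfolding ext_class_eq_iff
    by (simp add: ext_class_def flip: free_map_diff)
  show "\<mu> = ext_class (free_map P f)" if "\<forall>g\<in>ext_class f. ext_class (free_map P g) = \<mu>" for \<mu>
    using that mem_ext_class_self by metis
qed

lemma ext_map_blade_of: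
  "module_hom scale scale P \<Longrightarrow> ext_map P (blade_of c us) = blade_of c (map P us)"
  by (simp add: blade_of_def ext_map_ext_class)

section \<open>Gram determinants and orthogonal projections\<close>

text \<open>By multilinearity the vectors that make the wedge product vanish when put into the given
  slot form a subspace; by alternation it contains all other entries, hence their span.\<close>

lemma single_dependent_relation:
  assumes "u \<in> span (set us \<union> set ws)"
  shows "Poly_Mapping.single (us @ u # ws) c \<in> free.span ext_relations"
proof -
  let ?S = "free.span ext_relations"
  let ?s = "\<lambda>x. Poly_Mapping.single (us @ x # ws)"
  \<comment> \<open>The generating relations are stated with leading coefficient 1; each of the
    three kinds is first scaled by \<open>c\<close>.\<close>
  have add: "?s (x + y) c - ?s x c - ?s y c \<in> ?S" for x y
  proof -
    have "?s (x + y) 1 - ?s x 1 - ?s y 1 \<in> ext_relations"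
      unfolding ext_relations_def by blast
    from free.span_scale[OF free.span_base[OF this], of c] show ?thesis
      by (simp add: free.scale_right_diff_distrib fscale_single)
  qed
  have scale: "?s (k *s x) c - fscale k (?s x c) \<in> ?S" for k x
  proof -
    have "?s (k *s x) 1 - ?s x k \<in> ext_relations"
      unfolding ext_relations_def by blast
    from free.span_scale[OF free.span_base[OF this], of c] show ?thesis
      by (simp add: free.scale_right_diff_distrib fscale_single mult.commute)
  qed
  have repeated: "Poly_Mapping.single (as @ x # bs @ x # cs) c \<in> ?S" for as x bs cs
  proof -
    have "Poly_Mapping.single (as @ x # bs @ x # cs) 1 \<in> ext_relations"
      unfolding ext_relations_def by blast
    from free.span_scale[OF free.span_base[OF this], of c] show ?thesis
      by (simp add: fscale_single)
  qed
  have "subspace {x. ?s x c \<in> ?S}"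
    unfolding subspace_def mem_Collect_eq
  proof (intro conjI ballI allI impI)
    show "?s 0 c \<in> ?S"
      using scale[of 0 0] by simp
    show "?s (x + y) c \<in> ?S" if "x \<in> {x. ?s x c \<in> ?S}" "y \<in> {x. ?s x c \<in> ?S}" for x y
      using free.span_add[OF free.span_add[OF add[of x y]]] that by fastforce
    show "?s (k *s x) c \<in> ?S" if "x \<in> {x. ?s x c \<in> ?S}" for k x
      using free.span_add[OF scale[of k x] free.span_scale[of _ _ k]] that by fastforce
  qed
  moreover have "set us \<union> set ws \<subseteq> {x. ?s x c \<in> ?S}"
  proof
    fix x assume "x \<in> set us \<union> set ws"
    then consider as bs where "us = as @ x # bs" | as bs where "ws = as @ x # bs"
      by (meson UnE split_list)
    then show "x \<in> {x. ?s x c \<in> ?S}"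
      by cases (use repeated in auto)
  qed
  ultimately show ?thesis
    using assms span_minimal by blast
qed

lemma list_ip_dependent:
  assumes "u \<in> span (set us \<union> set ws)"
  shows "list_ip vs (us @ u # ws) = 0"
  using linear_extension_list_ip_relation[OF single_dependent_relation[OF assms, of 1], of vs]
  by simp

text \<open>In the second argument the difference \<open>y - x\<close> contributes nothing, whatever
  the first one is; conjugate symmetry then allows the same exchange in the first.\<close>

lemma list_ip_self_replace:
  assumes "y - x \<in> span (set us \<union> set ws)"
  shows "list_ip (us @ y # ws) (us @ y # ws) = list_ip (us @ x # ws) (us @ x # ws)"
proof -
  have *: "list_ip vs (us @ y # ws) = list_ip vs (us @ x # ws)" for vs
    using list_ip_add[of vs us x "y - x" ws] list_ip_dependent[OF assms, of vs] by simp
  then show ?thesis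
    by (metis list_ip_conjugate)
qed

lemma list_ip_append_orthogonal:
  assumes "\<And>x y. x \<in> set xs \<Longrightarrow> y \<in> set ys \<Longrightarrow> ip y x = 0"
  shows "list_ip (xs @ ys) (xs @ ys) = list_ip xs xs * list_ip ys ys"
proof -
  let ?M = "\<lambda>xs. mat (length xs) (length xs) (\<lambda>(i, j). ip (xs ! i) (xs ! j))"
  have 0: "ip x y = 0" if "x \<in> set xs" "y \<in> set ys" for x y
    using assms[OF that] ip_eq_0_commute by blast
  have "?M (xs @ ys) = four_block_mat (?M xs) (0\<^sub>m (length xs) (length ys))
      (0\<^sub>m (length ys) (length xs)) (?M ys)"
    by (rule eq_matI) (auto simp: nth_append assms 0)
  then have "det (?M (xs @ ys)) = det (?M xs) * det (?M ys)"
    by (simp add: det_four_block_mat_lower_left_zero[where n = "length xs" and m = "length ys"])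
  then show ?thesis by (simp add: list_ip_def)
qed

lemma list_ip_Nil [simp]: "list_ip [] [] = 1"
  by (simp add: list_ip_def)

lemma list_ip_singleton [simp]: "list_ip [x] [y] = ip x y"
  by (simp add: list_ip_def det_single)

section \<open>Orthogonal complements and Gram-Schmidt\<close>

lemma subspace_orth_compl: "subspace (orth_compl U)"
  by (auto simp: subspace_def orth_compl_def ip_add_right ip_scale_right)

lemma orth_compl_span: "orth_compl (span S) = orth_compl S"
proof
  show "orth_compl (span S) \<subseteq> orth_compl S"
    by (auto simp: orth_compl_def span_base)
  show "orth_compl S \<subseteq> orth_compl (span S)"
  proof
    fix x assume "x \<in> orth_compl S"
    then have "S \<subseteq> {y. ip y x = 0}" by (auto simp: orth_compl_def)
    moreover have "subspace {y. ip y x = 0}"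
      by (auto simp: subspace_def ip_add_left ip_scale_left)
    ultimately have "span S \<subseteq> {y. ip y x = 0}" by (rule span_minimal)
    then show "x \<in> orth_compl (span S)" by (auto simp: orth_compl_def)
  qed
qed

text \<open>Gram-Schmidt by induction on \<open>S\<close>: for a new vector \<open>u\<close>, take
  its component \<open>z\<close> orthogonal to the old span and add to the old projection of
  \<open>x\<close> the projection onto \<open>z\<close>.\<close>

lemma orthogonal_decomposition:
  assumes "finite S"
  obtains y where "y \<in> span S" "x - y \<in> orth_compl (span S)"
proof -
  have "\<exists>y\<in>span S. x - y \<in> orth_compl S"
    using assms
  proof (induction S arbitrary: x)
    case empty
    show ?case by (auto simp: orth_compl_def)
  next
    case (insert u S)
    from insert.IH[of x] obtain y where y: "y \<in> span S" "x - y \<in> orth_compl S" by blast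
    from insert.IH[of u] obtain t where t: "t \<in> span S" "u - t \<in> orth_compl S" by blast
    define z where "z = u - t"
    \<comment> \<open>If \<open>u\<close> lies in the old span then \<open>z = 0\<close>, and
      division by zero gives \<open>c = 0\<close>, so the old projection is kept.\<close>
    define c where "c = ip z (x - y) / ip z z"
    have z_orth: "ip s z = 0" if "s \<in> span S" for s
      using t(2) that orth_compl_span[of S] by (auto simp: z_def orth_compl_def)
    have y_orth: "ip s (x - y) = 0" if "s \<in> span S" for s
      using y(2) that orth_compl_span[of S] by (auto simp: orth_compl_def)
    have "ip z (x - y - c *s z) = 0"
      by (cases "z = 0") (auto simp: c_def ip_diff_right[of _ "x - y"] ip_scale_right ip_self_eq_0_iff)
    moreover have S0: "ip s (x - y - c *s z) = 0" if "s \<in> span S" for s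
      using that by (simp add: ip_diff_right[of _ "x - y"] ip_scale_right z_orth y_orth)
    \<comment> \<open>Orthogonality to \<open>u\<close> is checked along \<open>u = t + z\<close>,
      with \<open>t\<close> in the old span.\<close>
    ultimately have "ip (t + z) (x - y - c *s z) = 0"
      using t(1) by (simp add: ip_add_left)
    then have "ip u (x - y - c *s z) = 0" by (simp add: z_def)
    then have "x - (y + c *s z) \<in> orth_compl (insert u S)"
      using S0 by (auto simp: orth_compl_def span_base diff_diff_eq)
    moreover have "span S \<subseteq> span (insert u S)"
      by (rule span_mono) auto
    then have "y + c *s z \<in> span (insert u S)"
      unfolding z_def using y(1) t(1)
      by (intro span_add span_scale span_diff) (auto intro: span_base)
    ultimately show ?case by blast
  qed
  then show ?thesis
    using that by (auto simp: orth_compl_span)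
qed

text \<open>Base times height: replacing \<open>x\<close> by its component orthogonal to the span of
  \<open>xs\<close> leaves the determinant unchanged and splits off one factor.\<close>

lemma list_ip_Cons_orthogonal:
  obtains z where "x - z \<in> span (set xs)" "z \<in> orth_compl (span (set xs))"
    "list_ip (x # xs) (x # xs) = ip z z * list_ip xs xs"
proof -
  obtain y where y: "y \<in> span (set xs)" "x - y \<in> orth_compl (span (set xs))"
    using orthogonal_decomposition[of "set xs"] by blast
  have "list_ip (x # xs) (x # xs) = list_ip ((x - y) # xs) ((x - y) # xs)"
    using list_ip_self_replace[of x "x - y" "[]" xs] y(1) by simp
  also have "\<dots> = ip (x - y) (x - y) * list_ip xs xs"
    using list_ip_append_orthogonal[of "[x - y]" xs] y(2)
    by (simp add: orth_compl_def span_base)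
  finally show ?thesis using that[of "x - y"] y by simp
qed

lemma gram_Cons_orthogonal:
  obtains z where "x - z \<in> span (set xs)" "z \<in> orth_compl (span (set xs))"
    "gram (x # xs) = re (ip z z) * gram xs"
proof -
  from list_ip_Cons_orthogonal obtain z
    where z: "x - z \<in> span (set xs)" "z \<in> orth_compl (span (set xs))"
      and eq: "list_ip (x # xs) (x # xs) = ip z z * list_ip xs xs" .
  have "list_ip (x # xs) (x # xs) = of_real (re (ip z z) * gram xs)"
    unfolding eq of_real_mult by (simp flip: ip_self list_ip_self)
  then have "gram (x # xs) = re (ip z z) * gram xs"
    by (simp only: gram_def re_of_real)
  with z that show ?thesis by blast
qed

lemma gram_Nil: "gram [] = 1"
  using re_of_real[of 1, where 'k='k] by (simp add: gram_def)

lemma gram_nonneg: "gram xs \<ge> 0"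
proof (induction xs)
  case (Cons x xs)
  then show ?case
    by (metis gram_Cons_orthogonal mult_nonneg_nonneg re_ip_nonneg)
qed (simp add: gram_Nil)

lemma gram_pos:
  assumes "distinct xs" "independent (set xs)"
  shows "gram xs > 0"
  using assms
proof (induction xs)
  case (Cons x xs)
  from gram_Cons_orthogonal obtain z where z: "x - z \<in> span (set xs)"
    and eq: "gram (x # xs) = re (ip z z) * gram xs" .
  have "x \<notin> span (set xs)"
    using Cons.prems by (simp add: independent_insert)
  with z have "z \<noteq> 0" by auto
  then have "re (ip z z) > 0" by (rule ip_pos)
  moreover have "gram xs > 0"
    using Cons by (auto simp: independent_insert)
  ultimately show ?case by (simp add: eq)
qed (simp add: gram_Nil)

text \<open>Squared heights are compared factor by factor. The result bounds the quotient of norms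
  in the Grassmann angle by 1.\<close>

lemma gram_contraction:
  assumes P: "module_hom scale scale P" and contr: "\<And>x. re (ip (P x) (P x)) \<le> re (ip x x)"
  shows "gram (map P xs) \<le> gram xs"
proof (induction xs)
  case (Cons x xs)
  have span_P: "span (P ` S) = P ` span S" for S
    using module_hom.span_image[OF P] .
  from gram_Cons_orthogonal obtain z where z: "x - z \<in> span (set xs)"
    and z_eq: "gram (x # xs) = re (ip z z) * gram xs" .
  from gram_Cons_orthogonal obtain z' where z': "P x - z' \<in> span (set (map P xs))"
      "z' \<in> orth_compl (span (set (map P xs)))"
    and z'_eq: "gram (P x # map P xs) = re (ip z' z') * gram (map P xs)" .
  \<comment> \<open>Both \<open>P z\<close> and \<open>z'\<close> differ from \<open>P x\<close> by
    a vector in the span of the images, so \<open>z'\<close> is the orthogonal component of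
    \<open>P z\<close> and no longer than it.\<close>
  have "P x - P z \<in> span (set (map P xs))"
    using imageI[OF z, of P] module_hom.diff[OF P, of x z] by (simp add: span_P)
  then have "(P x - z') - (P x - P z) \<in> span (set (map P xs))"
    using z'(1) span_diff by blast
  then have d: "P z - z' \<in> span (set (map P xs))" by simp
  then have "ip z' (P z - z') = 0"
    using z'(2) ip_eq_0_commute by (auto simp: orth_compl_def)
  then have "re (ip (P z) (P z)) = re (ip z' z') + re (ip (P z - z') (P z - z'))"
    using re_ip_add_orthogonal[of z' "P z - z'"] by simp
  then have "re (ip z' z') \<le> re (ip z z)"
    using re_ip_nonneg[of "P z - z'"] contr[of z] by simp
  then show ?case
    using Cons.IH by (simp add: z_eq z'_eq mult_mono re_ip_nonneg gram_nonneg)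
qed simp

text \<open>The remainder is sought in \<open>span S\<close>, which lies in the double complement.
  The third claim characterizes the projection in these terms and, with the orthogonal
  decomposition, yields the other two.\<close>

lemma orth_proj_orth_compl:
  assumes "finite S"
  shows "orth_proj (orth_compl (span S)) x \<in> orth_compl (span S)"
    and "x - orth_proj (orth_compl (span S)) x \<in> span S"
    and "y \<in> orth_compl (span S) \<Longrightarrow> x - y \<in> span S \<Longrightarrow> orth_proj (orth_compl (span S)) x = y"
proof -
  let ?U = "orth_compl (span S)"
  have eq: "orth_proj ?U x = y" if y: "y \<in> ?U" "x - y \<in> span S" for y
    unfolding orth_proj_def
  proof (rule the_equality)
    show "y \<in> ?U \<and> x - y \<in> orth_compl ?U"
      using y ip_eq_0_commute by (auto simp: orth_compl_def)
    fix t assume t: "t \<in> ?U \<and> x - t \<in> orth_compl ?U"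
    \<comment> \<open>The difference of two candidates lies in the complement and is orthogonal to
      both remainders, hence to itself.\<close>
    have "t - y \<in> ?U"
      using t y subspace_diff[OF subspace_orth_compl] by blast
    moreover from this have "ip (t - y) (x - t) = 0" "ip (x - y) (t - y) = 0"
      using t y by (auto simp: orth_compl_def)
    then have "ip (t - y) (x - t) = 0" "ip (t - y) (x - y) = 0"
      using ip_eq_0_commute by blast+
    then have "ip (t - y) (t - y) = 0"
      by (simp add: ip_diff_right)
    then show "t = y" by (simp add: ip_self_eq_0_iff)
  qed
  obtain t where "t \<in> span S" "x - t \<in> ?U"
    using orthogonal_decomposition[OF assms] .
  then have "orth_proj ?U x = x - t" "x - t \<in> ?U" "x - (x - t) \<in> span S"
    using eq[of "x - t"] by auto
  then show "orth_proj ?U x \<in> ?U" "x - orth_proj ?U x \<in> span S" by auto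
  show "y \<in> ?U \<Longrightarrow> x - y \<in> span S \<Longrightarrow> orth_proj ?U x = y" by (rule eq)
qed

lemma module_hom_orth_proj:
  assumes "finite S"
  shows "module_hom scale scale (orth_proj (orth_compl (span S)))"
proof -
  let ?U = "orth_compl (span S)"
  note P = orth_proj_orth_compl[OF assms]
  show ?thesis
  proof unfold_locales
    fix x y c
    have "(x - orth_proj ?U x) + (y - orth_proj ?U y) \<in> span S"
      using P(2) span_add by blast
    then show "orth_proj ?U (x + y) = orth_proj ?U x + orth_proj ?U y"
      using P(1) by (intro P(3) subspace_add[OF subspace_orth_compl]) (auto simp: algebra_simps)
    have "c *s (x - orth_proj ?U x) \<in> span S"
      using P(2) span_scale by blast
    then show "orth_proj ?U (c *s x) = c *s orth_proj ?U x"
      using P(1) by (intro P(3) subspace_scale[OF subspace_orth_compl])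
        (auto simp: scale_right_diff_distrib)
  qed
qed

lemma orth_proj_contraction:
  assumes "finite S"
  shows "re (ip (orth_proj (orth_compl (span S)) x) (orth_proj (orth_compl (span S)) x)) \<le> re (ip x x)"
proof -
  let ?y = "orth_proj (orth_compl (span S)) x"
  have "ip (x - ?y) ?y = 0"
    using orth_proj_orth_compl(1,2)[OF assms, of x] by (simp add: orth_compl_def)
  from re_ip_add_orthogonal[OF this] show ?thesis
    using re_ip_nonneg[of "x - ?y"] by simp
qed

section \<open>Blades representing a subspace and the Grassmann angle\<close>

lemma module_hom_identity: "module_hom scale scale (\<lambda>x. x)"
  by unfold_locales auto

text \<open>The factor is |det M|^2 for the matrix \<open>M\<close> of coordinates of
  \<open>us\<close> with respect to \<open>vs\<close>, chosen before \<open>P\<close> and so the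
  same for every linear \<open>P\<close>. Using it for the identity and for a projection shows that
  the quotient of the two Gram determinants does not depend on the basis.\<close>

lemma gram_change_of_basis:
  assumes us: "set us \<subseteq> span (set vs)" and vs: "distinct vs" and len: "length us = length vs"
  obtains r where "\<And>P. module_hom scale scale P \<Longrightarrow> gram (map P us) = r * gram (map P vs)"
proof -
  let ?n = "length vs"
  have "\<forall>u. \<exists>c. u \<in> span (set vs) \<longrightarrow> u = (\<Sum>a\<in>set vs. c a *s a)"
    by (auto simp: span_finite)
  then obtain c where c: "u = (\<Sum>a\<in>set vs. c u a *s a)" if "u \<in> span (set vs)" for u
    by metis
  define M where "M = mat ?n ?n (\<lambda>(i, j). c (us ! j) (vs ! i))"
  have "gram (map P us) = (norm (det M))\<^sup>2 * gram (map P vs)"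
    if P: "module_hom scale scale P" for P
  proof -
    \<comment> \<open>Here \<open>M\<close> multiplies the matrix from the right; the first argument
      is handled afterwards by conjugate symmetry.\<close>
    have *: "list_ip xs (map P us) = list_ip xs (map P vs) * det M" if xs: "length xs = ?n" for xs
    proof -
      let ?N = "mat ?n ?n (\<lambda>(i, j). ip (xs ! i) (map P vs ! j))"
      have "mat ?n ?n (\<lambda>(i, j). ip (xs ! i) (map P us ! j)) = ?N * M"
      proof (rule eq_matI)
        fix i j assume "i < dim_row (?N * M)" "j < dim_col (?N * M)"
        then have i: "i < ?n" and j: "j < ?n" by (auto simp: M_def)
        have "P (us ! j) = P (\<Sum>a\<in>set vs. c (us ! j) a *s a)"
          using c[of "us ! j"] us j len by (metis nth_mem subsetD)
        also have "\<dots> = (\<Sum>a\<in>set vs. c (us ! j) a *s P a)"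
          by (simp add: module_hom.sum[OF P] module_hom.scale[OF P])
        also have "\<dots> = (\<Sum>k<?n. c (us ! j) (vs ! k) *s P (vs ! k))"
          by (rule sum.reindex_bij_betw[OF bij_betw_nth, symmetric]) (use vs in auto)
        finally have "ip (xs ! i) (P (us ! j)) = (\<Sum>k<?n. c (us ! j) (vs ! k) * ip (xs ! i) (P (vs ! k)))"
          by (simp add: ip_sum_right ip_scale_right)
        then show "mat ?n ?n (\<lambda>(i, j). ip (xs ! i) (map P us ! j)) $$ (i, j) = (?N * M) $$ (i, j)"
          using i j len
          by (simp add: M_def scalar_prod_def mult.commute lessThan_atLeast0)
      qed (simp_all add: M_def)
      then show ?thesis
        using xs len det_mult[of ?N ?n M] by (simp add: list_ip_def M_def)
    qed
    have "list_ip (map P us) (map P us) = list_ip (map P us) (map P vs) * det M"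
      using * len by simp
    also have "\<dots> = conjugate (list_ip (map P vs) (map P vs) * det M) * det M"
      using *[of "map P vs"] list_ip_conjugate[of "map P us" "map P vs"] by simp
    also have "\<dots> = of_real ((norm (det M))\<^sup>2 * gram (map P vs))"
      using conjugate_mult_self_of_real[of "det M"]
      by (simp add: conjugate_dist_mul list_ip_self mult_ac)
    finally show "gram (map P us) = (norm (det M))\<^sup>2 * gram (map P vs)"
      by (simp only: gram_def re_of_real)
  qed
  then show ?thesis by (rule that)
qed

lemma ext_class_0: "ext_class 0 = blade_of 0 us"
  by (simp add: blade_of_def)

text \<open>A nonzero blade has no entry in the span of the others, which excludes both repetitions
  and dependence. So every representing blade comes from an ordered basis.\<close>

lemma representsE:
  assumes "represents \<nu> V"
  obtains c us where "c \<noteq> 0" "ordered_basis us V" "\<nu> = blade_of c us"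
proof -
  from assms obtain c us where \<nu>: "\<nu> \<noteq> ext_class 0" "\<nu> = blade_of c us" "V = span (set us)"
    by (auto simp: represents_def)
  have notin: "u \<notin> span (set as \<union> set bs)" if "us = as @ u # bs" for as u bs
    using \<nu>(1,2) single_dependent_relation[of u as bs c] that
    by (auto simp: blade_of_def ext_class_eq_iff)
  have "distinct us"
  proof (rule ccontr)
    assume "\<not> distinct us"
    then obtain as u bs cs where "us = as @ u # bs @ u # cs"
      using not_distinct_decomp[of us] by auto
    from notin[OF this] show False by (simp add: span_base)
  qed
  moreover have "independent (set us)"
    unfolding dependent_def
  proof safe
    fix u assume u: "u \<in> set us" "u \<in> span (set us - {u})"
    then obtain as bs where us: "us = as @ u # bs" by (meson split_list)
    then have "span (set us - {u}) \<subseteq> span (set as \<union> set bs)"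
      by (intro span_mono) auto
    with notin[OF us] u(2) show False by blast
  qed
  moreover have "c \<noteq> 0" using \<nu>(1,2) ext_class_0 by auto
  ultimately show ?thesis
    using that \<nu> by (auto simp: ordered_basis_def)
qed

lemma gram_ordered_basis_pos: "ordered_basis vs V \<Longrightarrow> gram vs > 0"
  by (simp add: ordered_basis_def gram_pos)

text \<open>The blade is nonzero because its norm, the root of a positive Gram determinant, differs
  from that of \<open>blade_of 0 vs\<close>.\<close>

lemma represents_blade_of:
  assumes "ordered_basis vs V"
  shows "represents (blade_of 1 vs) V"
proof -
  have "ext_norm (blade_of 1 vs) \<noteq> ext_norm (blade_of 0 vs)"
    using gram_ordered_basis_pos[OF assms] by (simp add: ext_norm_blade_of)
  then have "blade_of 1 vs \<noteq> ext_class 0"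
    by (auto simp: ext_class_0[of vs])
  then show ?thesis
    using assms by (auto simp: represents_def ordered_basis_def)
qed

lemma ordered_basis_length:
  assumes "ordered_basis us V" "ordered_basis vs V"
  shows "length us = length vs"
  using assms dim_span_eq_card_independent[of "set us"] dim_span_eq_card_independent[of "set vs"]
  by (simp add: ordered_basis_def distinct_card)

text \<open>The quotient of norms takes the same value \<open>r\<close> on all representing blades
  and lies between 0 and 1, the upper bound coming from the contraction hypothesis; so
  \<open>arccos r\<close> is the one angle described.\<close>

lemma cos_grassmann_angle:
  assumes vs: "ordered_basis vs V" and P: "module_hom scale scale (orth_proj U)"
    and contr: "\<And>x. re (ip (orth_proj U x) (orth_proj U x)) \<le> re (ip x x)"
  shows "cos (grassmann_angle V U) = sqrt (gram (map (orth_proj U) vs) / gram vs)"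
proof -
  let ?P = "orth_proj U"
  let ?ratio = "\<lambda>\<nu>. ext_norm (ext_map ?P \<nu>) / ext_norm \<nu>"
  define r where "r = sqrt (gram (map ?P vs) / gram vs)"
  have ratio: "?ratio \<nu> = r" if "represents \<nu> V" for \<nu>
    using that
  proof (rule representsE)
    fix c us assume c: "c \<noteq> 0" and us: "ordered_basis us V" and \<nu>: "\<nu> = blade_of c us"
    have "set us \<subseteq> span (set vs)" "distinct vs"
      using us vs span_superset by (auto simp: ordered_basis_def)
    \<comment> \<open>One factor \<open>k\<close> serves both the blade and its image, so it cancels
      in the quotient, as does \<open>c\<close>.\<close>
    then obtain k where k: "gram (map Q us) = k * gram (map Q vs)" if "module_hom scale scale Q" for Q
      using gram_change_of_basis ordered_basis_length[OF us vs] by metis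
    have "gram us = k * gram vs"
      using k[of "\<lambda>x. x"] by (simp add: module_hom_identity)
    with gram_ordered_basis_pos[OF us] have "k \<noteq> 0" by auto
    with c show "?ratio \<nu> = r"
      using k[OF P] \<open>gram us = k * gram vs\<close>
      by (simp add: \<nu> ext_map_blade_of[OF P] ext_norm_blade_of r_def flip: real_sqrt_divide)
  qed
  have r: "0 \<le> r" "r \<le> 1"
    using gram_contraction[OF P contr, of vs] gram_ordered_basis_pos[OF vs] gram_nonneg[of "map ?P vs"]
    by (auto simp: r_def)
  have "grassmann_angle V U = arccos r"
    unfolding grassmann_angle_def
  proof (rule the_equality)
    show "0 \<le> arccos r \<and> arccos r \<le> pi / 2 \<and> (\<forall>\<nu>. represents \<nu> V \<longrightarrow> cos (arccos r) = ?ratio \<nu>)"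
      using r ratio arccos_le_pi2[of r] by (simp add: arccos_lbound)
    fix \<theta> assume \<theta>: "0 \<le> \<theta> \<and> \<theta> \<le> pi / 2 \<and> (\<forall>\<nu>. represents \<nu> V \<longrightarrow> cos \<theta> = ?ratio \<nu>)"
    \<comment> \<open>Uniqueness rests on there being some blade that represents \<open>V\<close>,
      namely \<open>blade_of 1 vs\<close>.\<close>
    then have "cos \<theta> = r"
      using represents_blade_of[OF vs] ratio by auto
    then show "\<theta> = arccos r"
      using \<theta> arccos_cos[of \<theta>] by auto
  qed
  then have "cos (grassmann_angle V U) = r"
    using r by simp
  then show ?thesis
    by (simp only: r_def)
qed

text \<open>Entries are replaced from left to right. Each replaced entry joins the prefix, whose
  span only grows, so the hypothesis persists in the induction with \<open>us\<close>
  arbitrary.\<close>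

lemma list_ip_map_modulo_prefix:
  assumes "\<And>x. x - P x \<in> span (set us)"
  shows "list_ip (us @ vs) (us @ vs) = list_ip (us @ map P vs) (us @ map P vs)"
  using assms
proof (induction vs arbitrary: us)
  case (Cons v vs)
  have "v - P v \<in> span (set us \<union> set vs)"
    using Cons.prems[of v] span_mono[of "set us" "set us \<union> set vs"] by blast
  then have "list_ip (us @ v # vs) (us @ v # vs) = list_ip (us @ P v # vs) (us @ P v # vs)"
    by (rule list_ip_self_replace)
  moreover have "x - P x \<in> span (set (us @ [P v]))" for x
    using Cons.prems[of x] span_mono[of "set us" "set (us @ [P v])"] by auto
  from Cons.IH[OF this] have "list_ip (us @ P v # vs) (us @ P v # vs) =
      list_ip (us @ P v # map P vs) (us @ P v # map P vs)"
    by simp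
  ultimately show ?case by simp
qed simp

text \<open>Base times height for whole blocks: once \<open>vs\<close> is exchanged for its
  projections, the factor for \<open>ws\<close> cancels and the squared quotient of norms is
  left.\<close>

lemma cos_compl_grassmann_angle:
  assumes vs: "ordered_basis vs V" and ws: "ordered_basis ws W"
  shows "of_real ((cos (compl_grassmann_angle V W))\<^sup>2) =
    list_ip (ws @ vs) (ws @ vs) / (list_ip ws ws * list_ip vs vs)"
proof -
  have W: "W = span (set ws)" using ws by (simp add: ordered_basis_def)
  define P where "P = orth_proj (orth_compl W)"
  note proj = orth_proj_orth_compl[of "set ws", folded W, folded P_def, simplified]
  have "list_ip (ws @ vs) (ws @ vs) = list_ip (ws @ map P vs) (ws @ map P vs)"
    using proj(2) by (intro list_ip_map_modulo_prefix) (simp add: W)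
  also have "\<dots> = list_ip ws ws * list_ip (map P vs) (map P vs)"
  proof (rule list_ip_append_orthogonal)
    fix x y assume "x \<in> set ws" "y \<in> set (map P vs)"
    then have "ip x y = 0"
      using proj(1) W by (auto simp: orth_compl_def span_base)
    then show "ip y x = 0" by (simp add: ip_eq_0_commute)
  qed
  finally have "list_ip (ws @ vs) (ws @ vs) / (list_ip ws ws * list_ip vs vs) =
      of_real (gram (map P vs) / gram vs)"
    using gram_ordered_basis_pos[OF ws] by (simp add: list_ip_self)
  moreover have "cos (compl_grassmann_angle V W) = sqrt (gram (map P vs) / gram vs)"
    unfolding compl_grassmann_angle_def P_def W
    by (intro cos_grassmann_angle vs module_hom_orth_proj orth_proj_contraction) auto
  ultimately show ?thesis
    using gram_nonneg[of "map P vs"] gram_nonneg[of vs] by simp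
qed

end

section \<open>Schur complements\<close>

text \<open>A nonzero determinant makes \<open>D\<close> a unit, so \<open>the\<close> is applied to
  \<open>Some\<close> of an actual inverse.\<close>

lemma mat_inverse_det_nonzero:
  fixes D :: "'a::field mat"
  assumes D: "D \<in> carrier_mat n n" and "det D \<noteq> 0"
  shows "the (mat_inverse D) \<in> carrier_mat n n" "D * the (mat_inverse D) = 1\<^sub>m n"
proof -
  obtain E where "mat_inverse D = Some E"
    using mat_inverse(1)[OF D, where b = "()"] det_non_zero_imp_unit[OF D, where b = "()"] assms(2) by blast
  with mat_inverse(2)[OF D this] show
    "the (mat_inverse D) \<in> carrier_mat n n" "D * the (mat_inverse D) = 1\<^sub>m n"
    by auto
qed

text \<open>Block elimination: the unit lower triangular factor \<open>?T\<close> subtracts from the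
  first block column the second one times \<open>E * C\<close>. This clears the lower left block and
  keeps the determinant.\<close>

lemma det_four_block_mat_Schur:
  fixes A :: "'a::field mat"
  assumes A: "A \<in> carrier_mat m m" and B: "B \<in> carrier_mat m n"
    and C: "C \<in> carrier_mat n m" and D: "D \<in> carrier_mat n n"
    and E: "E \<in> carrier_mat n n" "D * E = 1\<^sub>m n"
  shows "det (four_block_mat A B C D) = det (A - B * E * C) * det D"
proof -
  let ?T = "four_block_mat (1\<^sub>m m) (0\<^sub>m m n) (- (E * C)) (1\<^sub>m n)"
  have EC: "E * C \<in> carrier_mat n m" using E C by auto
  have "D * - (E * C) = - (D * E * C)" "B * - (E * C) = - (B * E * C)"
    using B C D E(1) EC by (simp_all add: assoc_mult_mat[OF _ E(1) C])
  moreover have "C + - C = 0\<^sub>m n m" "A + - (B * E * C) = A - B * E * C"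
    using A B C E(1) by (intro eq_matI; auto simp del: index_mult_mat(1))+
  ultimately have lower: "C * 1\<^sub>m m + D * - (E * C) = 0\<^sub>m n m"
    and upper: "A * 1\<^sub>m m + B * - (E * C) = A - B * E * C"
    using A C E(2) by simp_all
  have "four_block_mat A B C D * ?T = four_block_mat
      (A * 1\<^sub>m m + B * - (E * C)) (A * 0\<^sub>m m n + B * 1\<^sub>m n)
      (C * 1\<^sub>m m + D * - (E * C)) (C * 0\<^sub>m m n + D * 1\<^sub>m n)"
    using EC by (intro mult_four_block_mat[OF A B C D]) auto
  moreover have "A * 0\<^sub>m m n + B * 1\<^sub>m n = B" "C * 0\<^sub>m m n + D * 1\<^sub>m n = D"
    using A B C D by simp_all
  ultimately have "four_block_mat A B C D * ?T = four_block_mat (A - B * E * C) B (0\<^sub>m n m) D"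
    by (simp only: lower upper)
  moreover have "det ?T = 1"
    using EC by (subst det_four_block_mat_upper_right_zero[of _ m _ n]) auto
  moreover have "det (four_block_mat (A - B * E * C) B (0\<^sub>m n m) D) = det (A - B * E * C) * det D"
    using A B C D E by (intro det_four_block_mat_lower_left_zero) auto
  moreover have "det (four_block_mat A B C D * ?T) = det (four_block_mat A B C D) * det ?T"
    using A D EC by (intro det_mult) auto
  ultimately show ?thesis by simp
qed

theorem theorem3p7:
  fixes scale :: "'k::real_or_complex \<Rightarrow> 'x::ab_group_add \<Rightarrow> 'x"
    and Basis :: "'x set"
    and ip :: "'x \<Rightarrow> 'x \<Rightarrow> 'k"
    and V W :: "'x set"
    and vs ws :: "'x list"
    and p q :: nat
    and A B D :: "'k mat"
  assumes X: "inner_space scale Basis ip"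
    and v: "inner_space.ordered_basis scale vs V" "length vs = p"
    and w: "inner_space.ordered_basis scale ws W" "length ws = q"
    and A: "A = mat q q (\<lambda>(i, j). ip (ws ! i) (ws ! j))"
    and B: "B = mat q p (\<lambda>(i, j). ip (ws ! i) (vs ! j))"
    and D: "D = mat p p (\<lambda>(i, j). ip (vs ! i) (vs ! j))"
  shows "of_real ((cos (inner_space.compl_grassmann_angle scale ip V W))\<^sup>2) =
    det (A - B * the (mat_inverse D) * transpose_mat (map_mat conjugate B)) / det A"
proof -
  interpret inner_space scale Basis ip by (rule X)
  let ?C = "transpose_mat (map_mat conjugate B)"
  have D_eq: "list_ip vs vs = det D" and A_eq: "list_ip ws ws = det A"
    by (simp_all add: list_ip_def A D v w)
  \<comment> \<open>As the Gram determinant of a basis, \<open>det D\<close> is positive; so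
    \<open>mat_inverse D\<close> yields a genuine inverse and \<open>det D\<close> can be
    cancelled.\<close>
  have D0: "det D \<noteq> 0"
    using gram_ordered_basis_pos[OF v(1)] list_ip_self[of vs] by (simp flip: D_eq)
  have carr: "A \<in> carrier_mat q q" "B \<in> carrier_mat q p" "?C \<in> carrier_mat p q" "D \<in> carrier_mat p p"
    by (auto simp: A B D)
  \<comment> \<open>The lower left block has entries \<open>ip (vs ! i) (ws ! j)\<close>; by
    conjugate symmetry it is the conjugate transpose of \<open>B\<close>.\<close>
  have "mat (q + p) (q + p) (\<lambda>(i, j). ip ((ws @ vs) ! i) ((ws @ vs) ! j)) = four_block_mat A B ?C D"
    by (rule eq_matI) (auto simp: A B D nth_append v w intro: ip_conjugate)
  then have "list_ip (ws @ vs) (ws @ vs) = det (four_block_mat A B ?C D)"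
    by (simp add: list_ip_def v w)
  also have "\<dots> = det (A - B * the (mat_inverse D) * ?C) * det D"
    by (rule det_four_block_mat_Schur[OF carr mat_inverse_det_nonzero[OF carr(4) D0]])
  finally show ?thesis
    using cos_compl_grassmann_angle[OF v(1) w(1)] D0 by (simp add: A_eq D_eq)
qed

end
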